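(* Let $k\ge1$, $m\ge0$, and let $n_1,\dots,n_k\ge2$ be pairwise coprime integers. Let $p(x)=\sum_{i=0}^{m+k-1}a_i(1-x)^i\in\mathbb{Q}[x]$ be a polynomial having no root in common with $1-x^{n_j}$ for $1\le j\le k$. For $i\ne j$ let $a_i^{(j)},b_i^{(j)}$ be positive integers with $a_i^{(j)}n_i-b_i^{(j)}n_j=1$, and put $a_j^{(j)}=1$. Then $$\frac{p(x)}{(1-x)^m}\prod_{j=1}^{k}\frac{1}{1-x^{n_j}}=\sum_{j=0}^{m+k-2}\frac{c_j}{(1-x)^{m+k-j}}+\sum_{j=1}^{k}\frac{h_j(x)}{1-x^{n_j}},$$ where $$c_j=\frac{1}{n_1\cdots n_k}\sum_{\substack{i,i_1,\dots,i_k\ge0\\ i+i_1+\cdots+i_k=j}}a_i\,f^{(n_1)}_{i_1}(1)\cdots f^{(n_k)}_{i_k}(1)$$ and $$h_j(x)=\Big(p(x)\,f^{(n_j)}_{m+k-1}(x)\sum_{i_1=0}^{a_1^{(j)}-1}\cdots\sum_{i_k=0}^{a_k^{(j)}-1}x^{(i_1n_1+\cdots+i_kn_k)\%n_j}\Big)\ \mathrm{rem}\ \Psi_{n_j}(x).$$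
   Context: For $n\ge2$, $\Psi_n(x)=\frac{1-x^n}{1-x}=1+x+\cdots+x^{n-1}$. For $f,p\in\mathbb{Q}[x]$ with $p\neq0$, $f\ \mathrm{rem}\ p$ denotes the remainder of $f$ on Euclidean division by $p$. For integers, $a\%n$ denotes the remainder in $\{0,\dots,n-1\}$ of $a$ modulo $n$. For $n\ge 2$ and $j\ge0$, $f^{(n)}_j(x)=\big(-\tfrac1n x\Psi_n'(x)\big)^j\ \mathrm{rem}\ \Psi_n(x)$, with $f^{(n)}_0(x)=1$. The superscripted integers $a_i^{(j)}$ are unrelated to the coefficients $a_i$ of $p$. *)

theory Defs
  imports
    "HOL-Computational_Algebra.Computational_Algebra"
    "HOL-Library.FuncSet"
begin

definition Psi :: "nat \<Rightarrow> rat poly" where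
  "Psi n = (\<Sum>i<n. [:0, 1:] ^ i)"

text \<open>Psi n is the polynomial quotient of 1 - x^n by 1 - x.\<close>

lemma one_minus_x_mult_Psi: "(1 - [:0, 1:]) * Psi n = 1 - [:0, 1:] ^ n"
  unfolding Psi_def by (rule one_diff_power_eq [symmetric])

text \<open>The remainder f rem p is the Euclidean \<open>mod\<close> of the field polynomials over \<open>rat\<close>.\<close>

definition f_poly :: "nat \<Rightarrow> nat \<Rightarrow> rat poly" where
  "f_poly n j = (smult (- (1 / of_nat n)) ([:0, 1:] * pderiv (Psi n))) ^ j mod Psi n"

lemma degree_Psi:
  assumes "n \<ge> 1" shows "degree (Psi n) = n - 1"
proof -
  have "Psi n = (\<Sum>i<n. monom 1 i)"
    by (simp add: Psi_def monom_altdef)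
  then have c: "coeff (Psi n) i = (if i < n then 1 else 0)" for i
    by (simp add: coeff_sum sum.delta if_distrib cong: if_cong)
  show ?thesis
    using assms by (intro antisym degree_le le_degree) (auto simp: c)
qed

lemma f_poly_0:
  assumes "n \<ge> 2" shows "f_poly n 0 = 1"
  using assms by (simp add: f_poly_def mod_poly_less degree_Psi)

text \<open>Index tuples (i_1,...,i_k) are extensional functions on \<open>{1..k}\<close>, so that
  each tuple is counted exactly once in a sum. The set below consists of all (i, i_1,...,i_k)
  of naturals with i + i_1 + ... + i_k = j.\<close>

definition weak_comps :: "nat \<Rightarrow> nat \<Rightarrow> (nat \<times> (nat \<Rightarrow> nat)) set" where
  "weak_comps k j =
     {(i, t). t \<in> {1..k} \<rightarrow>\<^sub>E UNIV \<and> i + (\<Sum>l = 1..k. t l) = j}"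

text \<open>Finiteness matters because a sum over an infinite set is 0 by convention.\<close>

lemma finite_weak_comps: "finite (weak_comps k j)"
proof (rule finite_subset)
  show "weak_comps k j \<subseteq> {..j} \<times> ({1..k} \<rightarrow>\<^sub>E {..j})"
  proof (clarify, intro conjI SigmaI)
    fix i t assume h: "(i, t) \<in> weak_comps k j"
    then show "i \<in> {..j}" by (auto simp: weak_comps_def)
    have "t l \<le> j" if "l \<in> {1..k}" for l
      using h member_le_sum [of l "{1..k}" t] that by (auto simp: weak_comps_def)
    then show "t \<in> {1..k} \<rightarrow>\<^sub>E {..j}"
      using h by (auto simp: weak_comps_def PiE_iff)
  qed
  show "finite ({..j} \<times> ({1..k} \<rightarrow>\<^sub>E {..j}))"
    by (intro finite_cartesian_product finite_PiE) auto
qed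

text \<open>Here \<open>a i\<close> is the coefficient of (1-x)^i in p.\<close>

definition c_coeff :: "nat \<Rightarrow> (nat \<Rightarrow> nat) \<Rightarrow> (nat \<Rightarrow> rat) \<Rightarrow> nat \<Rightarrow> rat" where
  "c_coeff k n a j =
     1 / (\<Prod>l = 1..k. of_nat (n l)) *
     (\<Sum>(i, t)\<in>weak_comps k j. a i * (\<Prod>l = 1..k. poly (f_poly (n l) (t l)) 1))"

text \<open>\<open>e i j\<close> stands for the superscripted integer a_i^(j).\<close>

definition h_poly ::
    "nat \<Rightarrow> nat \<Rightarrow> (nat \<Rightarrow> nat) \<Rightarrow> rat poly \<Rightarrow> (nat \<Rightarrow> nat \<Rightarrow> nat) \<Rightarrow> nat \<Rightarrow> rat poly" where
  "h_poly k m n p e j =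
     (p * f_poly (n j) (m + k - 1) *
       (\<Sum>t \<in> (\<Pi>\<^sub>E i\<in>{1..k}. {0..<e i j}).
          [:0, 1:] ^ ((\<Sum>i = 1..k. t i * n i) mod n j)))
     mod Psi (n j)"

end

theory Submission
  imports Defs "HOL-Number_Theory.Cong" "HOL-Computational_Algebra.Field_as_Ring"
begin

text \<open>Modulo \<open>\<Psi>\<^sub>n\<close> the polynomial \<open>f\<^sub>j\<close> is the inverse of \<open>(1 - x)\<^sup>j\<close>, and
  \<open>a n' = b n + 1\<close> makes \<open>1 + x\<^bsup>n'\<^esup> + \<dots> + x\<^bsup>(a-1)n'\<^esup>\<close> the inverse of \<open>\<Psi>\<^bsub>n'\<^esub>\<close>, since
  \<open>1 - x\<^bsup>n'\<^esup>\<close> times this sum is \<open>1 - x\<^bsup>bn+1\<^esup>\<close>. At \<open>x = 1\<close>, the recursion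
  \<open>f\<^sub>j = f\<^sub>j(1)/n \<Psi>\<^sub>n + (1 - x) f\<^bsub>j+1\<^esub>\<close> shows that \<open>f\<^sub>j(1)/n\<close> is the coefficient of \<open>(1 - x)\<^sup>j\<close>
  in the expansion of \<open>1/\<Psi>\<^sub>n\<close>. After clearing denominators, the difference of the two sides is
  therefore divisible by \<open>(1 - x)\<^bsup>m+k-1\<^esup>\<close> and by each of the pairwise coprime \<open>\<Psi>\<^bsub>n_j\<^esub>\<close>; its
  degree is smaller than that of their product, so it vanishes. In particular no separate term of
  pole order 1 at \<open>x = 1\<close> is needed.\<close>

section \<open>Congruences modulo \<open>1 - x ^ n\<close> and modulo \<open>Psi n\<close>\<close>

lemma one_minus_power_mult_dvd:
  fixes x :: "'a :: comm_ring_1"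
  shows "1 - x ^ n dvd 1 - x ^ (n * b)"
  using one_diff_power_eq[of "x ^ n" b] by (simp add: power_mult)

text \<open>Every coprimality used below, between different \<open>Psi\<close>s and between a
  \<open>Psi\<close> and powers of 1 - x, comes from an explicit inverse in this way.\<close>

lemma cong_1_imp_coprime:
  fixes a :: "'a :: {unique_euclidean_semiring, semiring_gcd}"
  assumes "[a * b = 1] (mod m)"
  shows "coprime a m"
proof -
  have "coprime (a * b) m"
    using coprime_cong_transfer_left[of 1 m "a * b"] cong_sym[OF assms] by simp
  then show ?thesis by simp
qed

text \<open>Since \<open>Psi n\<close> divides \<open>1 - x ^ n\<close>, this allows the reduced
  exponents in \<open>h_poly\<close> to be replaced by unreduced ones, after which the sum
  factors.\<close>

lemma power_mod_cong_one_minus_power: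
  fixes x :: "rat poly"
  shows "[x ^ (s mod n) = x ^ s] (mod (1 - x ^ n))"
proof -
  have "[1 = x ^ (n * (s div n))] (mod (1 - x ^ n))"
    using one_minus_power_mult_dvd[of x n "s div n"] by (simp add: cong_iff_dvd_diff)
  from cong_mult[OF this cong_refl[of "x ^ (s mod n)"]] show ?thesis
    by (simp flip: power_add)
qed

lemma Psi_dvd: "Psi n dvd 1 - [:0, 1:] ^ n"
  by (metis one_minus_x_mult_Psi dvd_triv_right)

lemma Psi_neq_0: "n \<ge> 1 \<Longrightarrow> Psi n \<noteq> 0"
proof
  assume "n \<ge> 1" "Psi n = 0"
  then have "poly (Psi n) 1 = 0" by simp
  with \<open>n \<ge> 1\<close> show False by (simp add: Psi_def poly_sum)
qed

lemma poly_Psi_1: "poly (Psi n) 1 = of_nat n"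
  by (simp add: Psi_def poly_sum)

text \<open>Differentiating \<open>(1 - x) \<Psi>\<^sub>n = 1 - x\<^sup>n\<close> exhibits the inverse of \<open>1 - x\<close>.\<close>

lemma one_minus_x_inverse_mod_Psi:
  assumes "n \<ge> 1"
  shows "[(1 - [:0, 1:]) * smult (- (1 / of_nat n)) ([:0, 1:] * pderiv (Psi n)) = 1] (mod Psi n)"
proof -
  define X :: "rat poly" where "X = [:0, 1:]"
  have dX: "pderiv X = 1" by (simp add: X_def pderiv_pCons)
  have id: "(1 - X) * Psi n = 1 - X ^ n"
    using one_minus_x_mult_Psi[of n] by (simp add: X_def)
  from arg_cong[OF this, of pderiv]
  have "(1 - X) * pderiv (Psi n) - Psi n = - smult (of_nat n) (X ^ (n - 1))"
    by (simp add: pderiv_mult pderiv_diff pderiv_power dX)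
  \<comment> \<open>The factor \<open>X\<close> raises \<open>X ^ (n - 1)\<close> to
    \<open>X ^ n\<close>, which is 1 modulo \<open>Psi n\<close>; this explains the factor x in
    \<open>f_poly\<close>.\<close>
  then have "X * ((1 - X) * pderiv (Psi n) - Psi n) = - smult (of_nat n) (X ^ n)"
    using assms by (simp add: power_eq_if)
  then have *: "X * (1 - X) * pderiv (Psi n) = X * Psi n - smult (of_nat n) (X ^ n)"
    by (simp add: algebra_simps)
  have "(1 - X) * smult (- (1 / of_nat n)) (X * pderiv (Psi n)) =
        smult (- (1 / of_nat n)) (X * (1 - X) * pderiv (Psi n))"
    by (simp add: mult_ac)
  also have "\<dots> = X ^ n - smult (1 / of_nat n) X * Psi n"
    unfolding * using assms by (simp add: smult_diff_right)
  also have "\<dots> - 1 = Psi n * - (1 - X + smult (1 / of_nat n) X)"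
    using id by (simp add: algebra_simps)
  finally show ?thesis
    unfolding cong_iff_dvd_diff X_def by (metis dvd_triv_left)
qed

lemma f_poly_cong_inverse:
  assumes "n \<ge> 1"
  shows "[(1 - [:0, 1:]) ^ j * f_poly n j = 1] (mod Psi n)"
proof -
  have "[((1 - [:0, 1:]) * smult (- (1 / of_nat n)) ([:0, 1:] * pderiv (Psi n))) ^ j = 1 ^ j]
    (mod Psi n)"
    by (intro cong_pow one_minus_x_inverse_mod_Psi assms)
  then show ?thesis
    unfolding f_poly_def power_mult_distrib by (simp add: cong_def mod_mult_right_eq)
qed

lemma degree_mod_Psi_less:
  assumes "n \<ge> 2"
  shows "degree (q mod Psi n) < n - 1"
  using degree_mod_less'[of "Psi n" q] assms Psi_neq_0[of n]
  by (cases "q mod Psi n = 0") (auto simp: degree_Psi)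

lemma degree_f_poly_less: "n \<ge> 2 \<Longrightarrow> degree (f_poly n j) < n - 1"
  unfolding f_poly_def by (rule degree_mod_Psi_less)

section \<open>The expansion of 1/\<open>Psi n\<close> in powers of 1 - x\<close>

text \<open>The two sides agree at x = 1 by the choice of the multiple of \<open>Psi n\<close>, and
  modulo \<open>Psi n\<close> because there each is inverse to the j-th power of 1 - x. Their
  difference is thus a multiple of \<open>(1 - x) * Psi n\<close>, which has degree n, but its own
  degree is below n.\<close>

lemma f_poly_step:
  assumes "n \<ge> 2"
  shows "f_poly n j =
    smult (poly (f_poly n j) 1 / of_nat n) (Psi n) + (1 - [:0, 1:]) * f_poly n (Suc j)"
proof -
  define Y :: "rat poly" where "Y = 1 - [:0, 1:]"
  define u where "u = poly (f_poly n j) 1 / of_nat n"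
  define r where "r = f_poly n j - smult u (Psi n) - Y * f_poly n (Suc j)"
  have "poly r 1 = 0"
    using assms by (simp add: r_def u_def Y_def poly_Psi_1)
  then have "Y dvd r"
    using minus_dvd_iff[of Y r] by (simp add: poly_eq_0_iff_dvd Y_def one_pCons)
  moreover have inv: "[Y ^ i * f_poly n i = 1] (mod Psi n)" for i
    unfolding Y_def using assms by (intro f_poly_cong_inverse) simp
  have cop: "coprime (Y ^ i) (Psi n)" for i
    using inv[of i] by (rule cong_1_imp_coprime)
  have "Psi n dvd Y ^ j * r"
  proof -
    have "Psi n dvd Y ^ j * f_poly n j - Y ^ Suc j * f_poly n (Suc j)"
      using cong_trans[OF inv[of j] cong_sym[OF inv[of "Suc j"]]] by (simp add: cong_iff_dvd_diff)
    moreover have "Y ^ j * r = (Y ^ j * f_poly n j - Y ^ Suc j * f_poly n (Suc j))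
        - Psi n * smult u (Y ^ j)"
      by (simp add: r_def algebra_simps)
    ultimately show ?thesis by (metis dvd_diff dvd_triv_left)
  qed
  then have "Psi n dvd r"
    using cop[of j] by (metis coprime_commute coprime_dvd_mult_right_iff)
  ultimately have "Y * Psi n dvd r"
    using cop[of 1] by (auto intro: divides_mult)
  have degY: "degree Y = 1" by (simp add: Y_def one_pCons)
  have "degree r < n"
  proof -
    have "degree (f_poly n j) \<le> n - 1" "degree (smult u (Psi n)) \<le> n - 1"
      using degree_f_poly_less[OF assms, of j] assms by (auto simp: degree_Psi)
    moreover have "degree (Y * f_poly n (Suc j)) \<le> n - 1"
      using degree_mult_le[of Y "f_poly n (Suc j)"] degree_f_poly_less[OF assms, of "Suc j"] degY
      by linarith
    ultimately have "degree r \<le> n - 1"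
      unfolding r_def by (intro degree_diff_le)
    then show ?thesis using assms by simp
  qed
  moreover have "degree (Y * Psi n) = n"
    using assms degY Psi_neq_0[of n] by (subst degree_mult_eq) (auto simp: degree_Psi)
  ultimately have "r = 0"
    using \<open>Y * Psi n dvd r\<close> dvd_imp_degree_le[of "Y * Psi n" r] by linarith
  then show ?thesis by (simp add: r_def u_def Y_def)
qed

text \<open>Unrolls \<open>f_poly_step\<close> \<open>M\<close> times, starting from
  \<open>f_poly n 0 = 1\<close>. The sum is the Taylor polynomial of 1/\<open>Psi n\<close> at x =
  1, with an exact error term.\<close>

lemma Psi_truncated_inverse:
  assumes "n \<ge> 2"
  shows "Psi n * (\<Sum>i<M. smult (poly (f_poly n i) 1 / of_nat n) ((1 - [:0, 1:]) ^ i)) +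
    f_poly n M * (1 - [:0, 1:]) ^ M = 1"
proof (induction M)
  case 0
  show ?case using assms by (simp add: f_poly_0)
next
  case (Suc M)
  define Y :: "rat poly" where "Y = 1 - [:0, 1:]"
  have "f_poly n M * Y ^ M =
    (smult (poly (f_poly n M) 1 / of_nat n) (Psi n) + Y * f_poly n (Suc M)) * Y ^ M"
    unfolding Y_def using f_poly_step[OF assms, of M] by (rule arg_cong)
  with Suc show ?case
    unfolding Y_def[symmetric] by (simp add: algebra_simps)
qed

section \<open>Inverting one \<open>Psi\<close> modulo another\<close>

lemma Psi_inverse_mod_Psi:
  assumes "e * n' = b * n + 1"
  shows "[Psi n' * (\<Sum>t<e. [:0, 1:] ^ (t * n')) = 1] (mod Psi n)"
proof -
  define X :: "rat poly" where "X = [:0, 1:]"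
  have "(1 - X) * (Psi n' * (\<Sum>t<e. X ^ (t * n'))) = (1 - X ^ n') * (\<Sum>t<e. (X ^ n') ^ t)"
    using one_minus_x_mult_Psi[of n'] by (simp add: X_def mult.assoc[symmetric] power_mult mult.commute[of _ n'])
  also have "\<dots> = 1 - (X ^ n') ^ e"
    by (rule one_diff_power_eq[symmetric])
  also have "\<dots> = 1 - X ^ (b * n + 1)"
    by (simp add: assms flip: power_mult add: mult.commute[of n'])
  also have "\<dots> = (1 - X) + X * (1 - X ^ (n * b))"
    by (simp add: algebra_simps)
  \<comment> \<open>The factor \<open>1 - X\<close> is kept explicit, so that it cancels from an
    identity of polynomials and not merely from a congruence.\<close>
  also obtain w where "1 - X ^ (n * b) = (1 - X) * (Psi n * w)"
    using one_minus_power_mult_dvd[of X n b] one_minus_x_mult_Psi[of n]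
    by (metis X_def dvdE mult.assoc)
  finally have "(1 - X) * (Psi n' * (\<Sum>t<e. X ^ (t * n'))) = (1 - X) * (1 + Psi n * (X * w))"
    by (simp add: algebra_simps)
  moreover have "1 - X \<noteq> 0" by (simp add: X_def one_pCons)
  ultimately have "Psi n' * (\<Sum>t<e. X ^ (t * n')) = 1 + Psi n * (X * w)"
    by (metis mult_left_cancel)
  then show ?thesis
    unfolding cong_iff_dvd_diff X_def by (metis add_diff_cancel_left' dvd_triv_left)
qed

section \<open>The coefficients c_j\<close>

text \<open>Expanding the product gives one term for each element of \<open>S\<close>. The terms of
  total exponent below \<open>M\<close> are indexed by \<open>W\<close>, the disjoint union of the
  \<open>weak_comps k j\<close>; all others are multiples of \<open>Y ^ M\<close>.\<close>

lemma truncated_power_product: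
  fixes Y :: "rat poly"
  shows "[(\<Sum>i = 0..M. smult (a i) (Y ^ i)) * (\<Prod>l = 1..k. \<Sum>i<M. smult (u l i) (Y ^ i)) =
    (\<Sum>j<M. smult (\<Sum>(i, t)\<in>weak_comps k j. a i * (\<Prod>l = 1..k. u l (t l))) (Y ^ j))] (mod Y ^ M)"
proof -
  define F where "F = (\<lambda>(i, t). smult (a i * (\<Prod>l = 1..k. u l (t l))) (Y ^ (i + (\<Sum>l = 1..k. t l))))"
  define S where "S = {0..M} \<times> ({1..k} \<rightarrow>\<^sub>E {..<M})"
  define W where "W = (\<Union>j<M. weak_comps k j)"
  have fin: "finite S" unfolding S_def by (intro finite_cartesian_product finite_PiE) auto
  have W_iff: "(i, t) \<in> W \<longleftrightarrow> t \<in> {1..k} \<rightarrow>\<^sub>E UNIV \<and> i + (\<Sum>l = 1..k. t l) < M" for i t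
    by (auto simp: W_def weak_comps_def)
  \<comment> \<open>A total below \<open>M\<close> forces every entry below \<open>M\<close>, so
    truncating the factors loses none of these terms.\<close>
  have "W \<subseteq> S"
  proof (clarify)
    fix i t assume "(i, t) \<in> W"
    then have h: "t \<in> {1..k} \<rightarrow>\<^sub>E UNIV" "i + (\<Sum>l = 1..k. t l) < M" by (auto simp: W_iff)
    have "t l < M" if "l \<in> {1..k}" for l
      using h member_le_sum[of l "{1..k}" t] that by auto
    with h show "(i, t) \<in> S" by (auto simp: S_def PiE_iff)
  qed
  have "(\<Prod>l = 1..k. \<Sum>i<M. smult (u l i) (Y ^ i)) =
      (\<Sum>t\<in>{1..k} \<rightarrow>\<^sub>E {..<M}. smult (\<Prod>l = 1..k. u l (t l)) (Y ^ (\<Sum>l = 1..k. t l)))"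
    by (subst prod_sum_PiE) (auto simp: prod_smult power_sum)
  then have "(\<Sum>i = 0..M. smult (a i) (Y ^ i)) * (\<Prod>l = 1..k. \<Sum>i<M. smult (u l i) (Y ^ i)) = sum F S"
    by (simp add: F_def S_def sum_product sum.cartesian_product power_add mult.commute)
  also have "\<dots> = sum F (S - W) + sum F W"
    using \<open>W \<subseteq> S\<close> fin by (rule sum.subset_diff)
  also have "sum F W = (\<Sum>j<M. sum F (weak_comps k j))"
    unfolding W_def
    by (rule sum.UNION_disjoint) (auto simp: finite_weak_comps, auto simp: weak_comps_def)
  also have "\<dots> = (\<Sum>j<M. smult (\<Sum>(i, t)\<in>weak_comps k j. a i * (\<Prod>l = 1..k. u l (t l))) (Y ^ j))"
    by (intro sum.cong refl) (auto simp: smult_sum F_def weak_comps_def intro!: sum.cong)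
  finally show ?thesis
    by (auto simp: cong_iff_dvd_diff S_def W_iff F_def PiE_iff
        intro!: dvd_sum dvd_smult le_imp_power_dvd)
qed

text \<open>The c_j are the first \<open>M\<close> coefficients of p divided by the product of the
  \<open>Psi (n l)\<close>: each \<open>Psi (n l)\<close> is inverted modulo \<open>Y ^ M\<close> by
  its truncated expansion \<open>T l\<close>.\<close>

lemma c_coeff_cong:
  assumes n: "\<And>l. l \<in> {1..k} \<Longrightarrow> n l \<ge> 2"
  defines "Y \<equiv> 1 - [:0, 1:]"
  shows "[(\<Sum>j<M. smult (c_coeff k n a j) (Y ^ j)) * (\<Prod>l = 1..k. Psi (n l)) =
    (\<Sum>i = 0..M. smult (a i) (Y ^ i))] (mod Y ^ M)"
proof -
  define u where "u l i = poly (f_poly (n l) i) 1 / of_nat (n l)" for l i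
  define T where "T l = (\<Sum>i<M. smult (u l i) (Y ^ i))" for l
  define p where "p = (\<Sum>i = 0..M. smult (a i) (Y ^ i))"
  define P where "P = (\<Prod>l = 1..k. Psi (n l))"
  \<comment> \<open>The prefactor 1/(n_1...n_k) is shared out, one 1/n_l to each factor.\<close>
  have c: "c_coeff k n a j = (\<Sum>(i, t)\<in>weak_comps k j. a i * (\<Prod>l = 1..k. u l (t l)))" for j
    by (auto simp: c_coeff_def u_def prod_dividef sum_divide_distrib intro!: sum.cong)
  have "[Psi (n l) * T l = 1] (mod Y ^ M)" if "l \<in> {1..k}" for l
  proof -
    have "Psi (n l) * T l + f_poly (n l) M * Y ^ M = 1"
      using Psi_truncated_inverse[OF n[OF that], of M] by (simp add: T_def u_def Y_def)
    then have "Psi (n l) * T l - 1 = - (f_poly (n l) M * Y ^ M)"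
      by (simp add: algebra_simps eq_neg_iff_add_eq_0)
    then show ?thesis by (simp add: cong_iff_dvd_diff)
  qed
  then have "[(\<Prod>l = 1..k. Psi (n l) * T l) = (\<Prod>l = 1..k. 1)] (mod Y ^ M)"
    by (rule cong_prod)
  then have "[P * prod T {1..k} = 1] (mod Y ^ M)"
    by (simp add: prod.distrib P_def)
  then have "[p * (P * prod T {1..k}) = p * 1] (mod Y ^ M)"
    by (rule cong_mult[OF cong_refl])
  then have "[p * prod T {1..k} * P = p] (mod Y ^ M)"
    by (simp only: mult_ac mult_1_right mult_1_left)
  moreover have "[p * prod T {1..k} * P = (\<Sum>j<M. smult (c_coeff k n a j) (Y ^ j)) * P] (mod Y ^ M)"
    unfolding p_def T_def c by (intro cong_mult cong_refl truncated_power_product)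
  ultimately show ?thesis
    unfolding p_def[symmetric] P_def[symmetric] by (blast intro: cong_sym cong_trans)
qed

section \<open>The numerators h_j\<close>

text \<open>The sum over tuples in \<open>h_poly\<close> factors modulo \<open>Psi (n j)\<close>
  into geometric sums \<open>E i\<close>, where \<open>E i\<close> inverts \<open>Psi (n i)\<close>
  for i different from j, while \<open>f_poly\<close> inverts the power of 1 - x. Only p is
  left.\<close>

lemma h_poly_cong:
  assumes "j \<in> {1..k}" "n j \<ge> 1" "e j j = 1"
    and e: "\<And>i. i \<in> {1..k} - {j} \<Longrightarrow> \<exists>b. e i j * n i = b * n j + 1"
  shows "[h_poly k m n p e j * (1 - [:0, 1:]) ^ (m + k - 1) * (\<Prod>i\<in>{1..k} - {j}. Psi (n i)) = p]
    (mod Psi (n j))"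
proof -
  define X :: "rat poly" where "X = [:0, 1:]"
  define E where "E i = (\<Sum>t<e i j. X ^ (t * n i))" for i
  define f where "f = f_poly (n j) (m + k - 1)"
  define R where "R = (\<Prod>i\<in>{1..k} - {j}. Psi (n i))"
  have "[(\<Sum>t \<in> (\<Pi>\<^sub>E i\<in>{1..k}. {0..<e i j}). X ^ ((\<Sum>i = 1..k. t i * n i) mod n j)) =
      (\<Sum>t \<in> (\<Pi>\<^sub>E i\<in>{1..k}. {0..<e i j}). X ^ (\<Sum>i = 1..k. t i * n i))] (mod Psi (n j))"
    using Psi_dvd[of "n j"] unfolding X_def
    by (intro cong_sum cong_dvd_modulus[OF power_mod_cong_one_minus_power])
  also have "(\<Sum>t \<in> (\<Pi>\<^sub>E i\<in>{1..k}. {0..<e i j}). X ^ (\<Sum>i = 1..k. t i * n i)) = prod E {1..k}"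
    unfolding E_def by (subst prod_sum_PiE) (auto simp: power_sum atLeast0LessThan)
  \<comment> \<open>As \<open>e j j = 1\<close>, the sum \<open>E j\<close> consists of the single
    term 1.\<close>
  also have "\<dots> = prod E ({1..k} - {j})"
    using assms by (subst prod.remove[of _ j]) (auto simp: E_def)
  finally have "[h_poly k m n p e j = p * f * prod E ({1..k} - {j})] (mod Psi (n j))"
    unfolding h_poly_def f_def X_def by (simp add: cong_mult)
  then have "[h_poly k m n p e j * ((1 - X) ^ (m + k - 1) * R) =
      p * f * prod E ({1..k} - {j}) * ((1 - X) ^ (m + k - 1) * R)] (mod Psi (n j))"
    by (intro cong_mult cong_refl)
  also have "p * f * prod E ({1..k} - {j}) * ((1 - X) ^ (m + k - 1) * R) =
      p * (((1 - X) ^ (m + k - 1) * f) * (\<Prod>i\<in>{1..k} - {j}. Psi (n i) * E i))"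
    by (simp add: R_def prod.distrib mult_ac)
  also have "[\<dots> = p * (1 * (\<Prod>i\<in>{1..k} - {j}. 1))] (mod Psi (n j))"
  proof (intro cong_mult cong_prod cong_refl)
    show "[(1 - X) ^ (m + k - 1) * f = 1] (mod Psi (n j))"
      unfolding X_def f_def using assms by (intro f_poly_cong_inverse) simp
    show "[Psi (n i) * E i = 1] (mod Psi (n j))" if "i \<in> {1..k} - {j}" for i
      using e[OF that] Psi_inverse_mod_Psi by (auto simp: E_def X_def)
  qed
  finally show ?thesis
    by (simp add: R_def X_def mult.assoc)
qed

section \<open>The identity with denominators cleared\<close>

text \<open>This is the partial fraction identity multiplied by \<open>Y ^ (m + k)\<close> and by
  all \<open>Psi (n i)\<close>; each \<open>1 - x ^ n i\<close> contributes one factor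
  \<open>Y\<close>.\<close>

lemma cleared_partial_fractions:
  fixes n :: "nat \<Rightarrow> nat" and m :: nat
  assumes k: "k \<ge> 1"
    and n: "\<And>j. j \<in> {1..k} \<Longrightarrow> n j \<ge> 2"
    and e: "\<And>i j. i \<in> {1..k} \<Longrightarrow> j \<in> {1..k} \<Longrightarrow> i \<noteq> j \<Longrightarrow> \<exists>b. e i j * n i = b * n j + 1"
    and e1: "\<And>j. j \<in> {1..k} \<Longrightarrow> e j j = 1"
  defines "Y \<equiv> 1 - [:0, 1:]" and "M \<equiv> m + k - 1"
  assumes p: "p = (\<Sum>i = 0..M. smult (a i) (Y ^ i))"
  shows "p = (\<Sum>j<M. smult (c_coeff k n a j) (Y ^ j)) * (\<Prod>i = 1..k. Psi (n i)) +
    (\<Sum>j = 1..k. h_poly k m n p e j * Y ^ M * (\<Prod>i\<in>{1..k} - {j}. Psi (n i)))"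
proof -
  define P where "P = (\<Prod>i = 1..k. Psi (n i))"
  define R where "R j = (\<Prod>i\<in>{1..k} - {j}. Psi (n i))" for j
  define C where "C = (\<Sum>j<M. smult (c_coeff k n a j) (Y ^ j))"
  define H where "H j = h_poly k m n p e j * Y ^ M * R j" for j
  define D where "D = p - C * P - (\<Sum>j = 1..k. H j)"
  have nz: "Psi (n j) \<noteq> 0" if "j \<in> {1..k}" for j
    using n[OF that] by (intro Psi_neq_0) simp
  have dPsi: "degree (Psi (n j)) = n j - 1" if "j \<in> {1..k}" for j
    using n[OF that] by (intro degree_Psi) simp
  have P_eq: "P = Psi (n j) * R j" if "j \<in> {1..k}" for j
    unfolding P_def R_def using that by (intro prod.remove) auto
  have "P \<noteq> 0" unfolding P_def using nz by simp
  have R_nz: "R j \<noteq> 0" for j unfolding R_def using nz by simp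
  have "Y \<noteq> 0" and dY: "degree Y = 1" by (simp_all add: Y_def one_pCons)
  have dYM: "degree (Y ^ i) = i" for i
    using \<open>Y \<noteq> 0\<close> by (simp add: degree_power_eq dY)
  have dP: "degree P = n j - 1 + degree (R j)" if "j \<in> {1..k}" for j
    unfolding P_eq[OF that] using nz[OF that] R_nz[of j] that by (simp add: degree_mult_eq dPsi)
  \<comment> \<open>The strict degree bounds below rest on this: p may have degree \<open>M\<close>,
    and a vanishing summand still has degree 0.\<close>
  have "degree P \<ge> 1"
    using dP[of 1] n[of 1] k by simp

  have "Y ^ M dvd D"
  proof -
    have "Y ^ M dvd C * P - p"
      using c_coeff_cong[of k n a M] n unfolding p C_def P_def Y_def
      by (simp add: cong_iff_dvd_diff)
    moreover have "Y ^ M dvd (\<Sum>j = 1..k. H j)"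
      by (intro dvd_sum) (simp add: H_def)
    moreover have "D = - (C * P - p) - (\<Sum>j = 1..k. H j)"
      by (simp add: D_def)
    ultimately show ?thesis by (simp only: dvd_diff dvd_minus_iff)
  qed
  moreover have Psi_dvd_D: "Psi (n j) dvd D" if j: "j \<in> {1..k}" for j
  proof -
    have "Psi (n j) dvd H j - p"
      using h_poly_cong[of j k n e m p] n[OF j] e1[OF j] e j
      unfolding H_def R_def Y_def M_def by (auto simp: cong_iff_dvd_diff)
    moreover have "Psi (n j) dvd (\<Sum>i\<in>{1..k} - {j}. H i)"
    proof (intro dvd_sum)
      fix i assume "i \<in> {1..k} - {j}"
      then have "Psi (n j) dvd R i"
        unfolding R_def using j by (intro dvd_prodI) auto
      then show "Psi (n j) dvd H i" unfolding H_def by (rule dvd_mult)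
    qed
    \<comment> \<open>Modulo \<open>Psi (n j)\<close> only \<open>H j\<close> and p matter:
      \<open>P\<close> contains \<open>Psi (n j)\<close>, and so does \<open>R i\<close> for every i
      other than j.\<close>
    moreover have "D = - (H j - p) - (\<Sum>i\<in>{1..k} - {j}. H i) - Psi (n j) * (C * R j)"
      unfolding D_def P_eq[OF j] using j by (subst sum.remove[of _ j]) (auto simp: mult_ac)
    ultimately show ?thesis by (simp only: dvd_diff dvd_minus_iff dvd_triv_left)
  qed
  have "P dvd D"
    unfolding P_def
  proof -
    have "A \<subseteq> {1..k} \<Longrightarrow> (\<Prod>i\<in>A. Psi (n i)) dvd D" if "finite A" for A
      using that
    proof (induction A rule: finite_induct)
      case (insert j A)
      have "coprime (Psi (n j)) (Psi (n i))" if "i \<in> A" for i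
      proof -
        from that insert have "j \<in> {1..k}" "i \<in> {1..k}" "j \<noteq> i" by auto
        then obtain b where "e j i * n j = b * n i + 1" using e by blast
        then show ?thesis by (rule cong_1_imp_coprime[OF Psi_inverse_mod_Psi])
      qed
      then have "coprime (Psi (n j)) (\<Prod>i\<in>A. Psi (n i))" by (rule prod_coprime_right)
      with insert Psi_dvd_D[of j] show ?case by (auto intro: divides_mult)
    qed simp
    then show "(\<Prod>i = 1..k. Psi (n i)) dvd D" by simp
  qed
  moreover have "coprime (Y ^ M) P"
    unfolding P_def Y_def
    by (intro prod_coprime_right cong_1_imp_coprime[OF f_poly_cong_inverse]) (use n in force)
  ultimately have "Y ^ M * P dvd D" by (intro divides_mult)
  moreover have "degree D < degree (Y ^ M * P)"
  proof -
    have dMP: "degree (Y ^ M * P) = M + degree P"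
      using \<open>Y \<noteq> 0\<close> \<open>P \<noteq> 0\<close> by (simp add: degree_mult_eq dYM)
    have "degree p \<le> M"
      unfolding p by (intro degree_sum_le) (auto intro: order.trans[OF degree_smult_le] simp: dYM)
    then have 1: "degree p < M + degree P" using \<open>degree P \<ge> 1\<close> by simp
    have 2: "degree (C * P) < M + degree P"
    \<comment> \<open>For \<open>M = 0\<close> the sum \<open>C\<close> is empty; otherwise its top
      power is \<open>Y ^ (M - 1)\<close>, one below \<open>M\<close>.\<close>
    proof (cases "M = 0")
      case True
      then show ?thesis using \<open>degree P \<ge> 1\<close> by (simp add: C_def)
    next
      case False
      have "degree C \<le> M - 1"
        unfolding C_def by (intro degree_sum_le) (auto intro: order.trans[OF degree_smult_le] simp: dYM)
      with False degree_mult_le[of C P] show ?thesis by linarith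
    qed
    have "degree (H j) < M + degree P" if j: "j \<in> {1..k}" for j
    proof -
      have "degree (h_poly k m n p e j) < n j - 1"
        unfolding h_poly_def by (rule degree_mod_Psi_less[OF n[OF j]])
      moreover have "degree (H j) \<le> degree (h_poly k m n p e j) + M + degree (R j)"
        using degree_mult_le[of "h_poly k m n p e j" "Y ^ M"]
          degree_mult_le[of "h_poly k m n p e j * Y ^ M" "R j"]
        unfolding H_def dYM by linarith
      ultimately show ?thesis using dP[OF j] by linarith
    qed
    then have 3: "degree (\<Sum>j = 1..k. H j) < M + degree P"
      using \<open>degree P \<ge> 1\<close> by (intro degree_sum_less) auto
    show ?thesis
      unfolding D_def dMP using 1 2 3 by (intro degree_diff_less)
  qed
  ultimately have "D = 0"
    using dvd_imp_degree_le[of "Y ^ M * P" D] by linarith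
  then show ?thesis by (simp add: D_def C_def P_def H_def R_def)
qed

section \<open>Passage to the field of fractions\<close>

lemma to_fract_prod: "to_fract (\<Prod>i\<in>A. f i) = (\<Prod>i\<in>A. to_fract (f i))"
  by (induction A rule: infinite_finite_induct) auto

lemma to_fract_power: "to_fract (x ^ i) = to_fract x ^ i"
  by (induction i) auto

theorem theorem4p11:
  fixes k m :: nat
    and n :: "nat \<Rightarrow> nat"
    and a :: "nat \<Rightarrow> rat"
    and p :: "rat poly"
    and e b :: "nat \<Rightarrow> nat \<Rightarrow> nat"
  assumes "k \<ge> 1"
    and "\<forall>j\<in>{1..k}. n j \<ge> 2"
    and "\<forall>i\<in>{1..k}. \<forall>j\<in>{1..k}. i \<noteq> j \<longrightarrow> coprime (n i) (n j)"
    and "p = (\<Sum>i = 0..m + k - 1. smult (a i) ((1 - [:0, 1:]) ^ i))"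
    and "\<forall>j\<in>{1..k}. \<not> (\<exists>z::complex. poly (map_poly of_rat p) z = 0 \<and>
                              poly (map_poly of_rat (1 - [:0, 1:] ^ n j)) z = 0)"
    and "\<forall>i\<in>{1..k}. \<forall>j\<in>{1..k}. i \<noteq> j \<longrightarrow>
           e i j > 0 \<and> b i j > 0 \<and> int (e i j) * int (n i) - int (b i j) * int (n j) = 1"
    and "\<forall>j\<in>{1..k}. e j j = 1"
  shows "to_fract p / to_fract ((1 - [:0, 1:]) ^ m) *
           (\<Prod>j = 1..k. 1 / to_fract (1 - [:0, 1:] ^ n j)) =
         (\<Sum>j<m + k - 1. to_fract [:c_coeff k n a j:] / to_fract ((1 - [:0, 1:]) ^ (m + k - j))) +
         (\<Sum>j = 1..k. to_fract (h_poly k m n p e j) / to_fract (1 - [:0, 1:] ^ n j))"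
proof -
  define Y :: "rat poly" where "Y = 1 - [:0, 1:]"
  define M where "M = m + k - 1"
  define y where "y = to_fract Y"
  define s where "s j = to_fract (Psi (n j))" for j
  \<comment> \<open>Since k is positive, the natural subtraction in \<open>M\<close> is
    exact.\<close>
  have M: "m + k = Suc M" using assms(1) by (simp add: M_def)
  have n: "n j \<ge> 2" if "j \<in> {1..k}" for j using assms(2) that by blast
  have s0: "s j \<noteq> 0" if "j \<in> {1..k}" for j
    using n[OF that] Psi_neq_0[of "n j"] by (simp add: s_def)
  have y0: "y \<noteq> 0" by (simp add: y_def Y_def one_pCons)
  define S where "S = prod s {1..k}"
  have S0: "S \<noteq> 0" using s0 by (simp add: S_def)
  have N: "to_fract (1 - [:0, 1:] ^ n j) = y * s j" for j
    unfolding y_def s_def Y_def one_minus_x_mult_Psi[symmetric] by (rule to_fract_mult)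
  have e: "\<exists>b. e i j * n i = b * n j + 1" if "i \<in> {1..k}" "j \<in> {1..k}" "i \<noteq> j" for i j
  proof -
    have "int (e i j) * int (n i) - int (b i j) * int (n j) = 1"
      using assms(6) that by blast
    then have "int (e i j * n i) = int (b i j * n j + 1)" by simp
    then show ?thesis by (metis of_nat_eq_iff)
  qed
  have "p = (\<Sum>j<M. smult (c_coeff k n a j) (Y ^ j)) * (\<Prod>i = 1..k. Psi (n i)) +
    (\<Sum>j = 1..k. h_poly k m n p e j * Y ^ M * (\<Prod>i\<in>{1..k} - {j}. Psi (n i)))"
    unfolding Y_def M_def
    using assms(1,4,7) n e by (intro cleared_partial_fractions) auto
  then have "to_fract p = to_fract ((\<Sum>j<M. [:c_coeff k n a j:] * Y ^ j) * (\<Prod>i = 1..k. Psi (n i)) +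
    (\<Sum>j = 1..k. h_poly k m n p e j * Y ^ M * (\<Prod>i\<in>{1..k} - {j}. Psi (n i))))"
    by simp
  also have "\<dots> = (\<Sum>j<M. to_fract [:c_coeff k n a j:] * y ^ j) * S +
      (\<Sum>j = 1..k. to_fract (h_poly k m n p e j) * y ^ M * prod s ({1..k} - {j}))"
    by (simp only: to_fract_add to_fract_mult to_fract_sum to_fract_prod to_fract_power
        y_def[symmetric] S_def s_def[symmetric])
  finally have p: "to_fract p = \<dots>" .
  \<comment> \<open>The k denominators \<open>1 - x ^ n j\<close> supply \<open>y ^ k\<close>, which
    joins \<open>y ^ m\<close> to form the common denominator \<open>y ^ Suc M * S\<close>.\<close>
  have "to_fract p / to_fract ((1 - [:0, 1:]) ^ m) * (\<Prod>j = 1..k. 1 / to_fract (1 - [:0, 1:] ^ n j)) =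
      to_fract p / (y ^ Suc M * S)"
    unfolding N Y_def[symmetric] to_fract_power M[symmetric]
    by (simp add: y_def S_def prod_dividef prod.distrib power_add)
  also have "\<dots> = (\<Sum>j<M. to_fract [:c_coeff k n a j:] * y ^ j * S / (y ^ Suc M * S)) +
      (\<Sum>j = 1..k. to_fract (h_poly k m n p e j) * y ^ M * prod s ({1..k} - {j}) / (y ^ Suc M * S))"
    unfolding p add_divide_distrib sum_distrib_right sum_divide_distrib ..
  also have "(\<Sum>j<M. to_fract [:c_coeff k n a j:] * y ^ j * S / (y ^ Suc M * S)) =
      (\<Sum>j<M. to_fract [:c_coeff k n a j:] / to_fract ((1 - [:0, 1:]) ^ (m + k - j)))"
  proof (intro sum.cong refl)
    fix j assume "j \<in> {..<M}"
    \<comment> \<open>Here j < \<open>M\<close> keeps the exponent \<open>m + k - j\<close> free of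
      truncation.\<close>
    then have "y ^ Suc M = y ^ j * y ^ (m + k - j)"
      by (simp add: M flip: power_add)
    then show "to_fract [:c_coeff k n a j:] * y ^ j * S / (y ^ Suc M * S) =
        to_fract [:c_coeff k n a j:] / to_fract ((1 - [:0, 1:]) ^ (m + k - j))"
      unfolding Y_def[symmetric] to_fract_power y_def[symmetric] using y0 S0 by simp
  qed
  also have "(\<Sum>j = 1..k. to_fract (h_poly k m n p e j) * y ^ M * prod s ({1..k} - {j}) / (y ^ Suc M * S)) =
      (\<Sum>j = 1..k. to_fract (h_poly k m n p e j) / to_fract (1 - [:0, 1:] ^ n j))"
  proof (intro sum.cong refl)
    fix j assume j: "j \<in> {1..k}"
    then have "S = s j * prod s ({1..k} - {j})"
      unfolding S_def by (intro prod.remove) auto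
    then show "to_fract (h_poly k m n p e j) * y ^ M * prod s ({1..k} - {j}) / (y ^ Suc M * S) =
        to_fract (h_poly k m n p e j) / to_fract (1 - [:0, 1:] ^ n j)"
      unfolding N using y0 S0 by simp
  qed
  finally show ?thesis by (simp add: M_def)
qed

end
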